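(* Let $G$ be a finite non-abelian group with center $Z$ of size $z$, and let $c_\star=\max\{|C_x|: x\in G\setminus Z\}$. For every $\varepsilon\in(0,1)$ the mixing time of the commuting chain on $G$ satisfies \[t_{mix}(\varepsilon)\le\left\lceil \frac{2c_\star}{z}\log\left(\frac1\varepsilon\right)+2\right\rceil .\]
   Context: For a finite group $G$ and $x\in G$, let $C_x=\{h\in G: hx=xh\}$ be the centralizer and $x^G$ the conjugacy class of $x$. The commuting chain on $G$ is the Markov chain with state space $G$ and transition matrix $P(x,y)=\frac{1}{|C_x|}\mathbf 1_{\{xy=yx\}}$; it is irreducible, aperiodic and reversible with stationary distribution $\pi(x)=\frac{1}{k|x^G|}$, where $k$ is the number of conjugacy classes of $G$. Total variation distance: $\Vert\mu-\nu\Vert_{TV}=\sup_{A}|\mu(A)-\nu(A)|$. Put $d(t)=\max_x\Vert P^t(x,\cdot)-\pi\Vert_{TV}$ and $t_{mix}(\varepsilon)=\min\{t: d(t)\le\varepsilon\}$. $\log$ is the natural logarithm. *)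

theory Defs
  imports
    Complex_Main
    "HOL-Algebra.Group_Action"
    "HOL-Library.Extended_Nat"
begin

subsection \<open>Markov chains on a finite state space\<close>

text \<open>
  A transition matrix on a state space \<open>S\<close> is a function \<open>P x y\<close> of which only the values
  at \<open>x, y \<in> S\<close> matter; a distribution on \<open>S\<close> is a mass function on \<open>S\<close>.
\<close>

primrec mat_pow :: "'a set \<Rightarrow> ('a \<Rightarrow> 'a \<Rightarrow> real) \<Rightarrow> nat \<Rightarrow> 'a \<Rightarrow> 'a \<Rightarrow> real" where
  "mat_pow S P 0 x y = (if x = y then 1 else 0)"
| "mat_pow S P (Suc t) x y = (\<Sum>w\<in>S. P x w * mat_pow S P t w y)"

definition tv_dist :: "'a set \<Rightarrow> ('a \<Rightarrow> real) \<Rightarrow> ('a \<Rightarrow> real) \<Rightarrow> real" where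
  "tv_dist S \<mu> \<nu> = (SUP A\<in>Pow S. \<bar>sum \<mu> A - sum \<nu> A\<bar>)"

definition worst_dist :: "'a set \<Rightarrow> ('a \<Rightarrow> 'a \<Rightarrow> real) \<Rightarrow> ('a \<Rightarrow> real) \<Rightarrow> nat \<Rightarrow> real" where
  "worst_dist S P \<pi> t = (MAX x\<in>S. tv_dist S (mat_pow S P t x) \<pi>)"

text \<open>
  The value lies in \<^typ>\<open>enat\<close>, so that the infimum is the minimum if some \<open>t\<close> qualifies and
  \<open>\<infinity>\<close> otherwise; a finite upper bound thus asserts that the minimum exists.
\<close>

definition mixing_time :: "'a set \<Rightarrow> ('a \<Rightarrow> 'a \<Rightarrow> real) \<Rightarrow> ('a \<Rightarrow> real) \<Rightarrow> real \<Rightarrow> enat" where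
  "mixing_time S P \<pi> \<epsilon> = Inf {enat t | t. worst_dist S P \<pi> t \<le> \<epsilon>}"

subsection \<open>The commuting chain on a group\<close>

definition center :: "('a, 'b) monoid_scheme \<Rightarrow> 'a set" where
  "center G = {x \<in> carrier G. \<forall>h\<in>carrier G. h \<otimes>\<^bsub>G\<^esub> x = x \<otimes>\<^bsub>G\<^esub> h}"

definition centralizer :: "('a, 'b) monoid_scheme \<Rightarrow> 'a \<Rightarrow> 'a set" where
  "centralizer G x = {h \<in> carrier G. h \<otimes>\<^bsub>G\<^esub> x = x \<otimes>\<^bsub>G\<^esub> h}"

text \<open>The action of the library theorem \<open>group.action_by_conjugation\<close>.\<close>

definition conj_action :: "('a, 'b) monoid_scheme \<Rightarrow> 'a \<Rightarrow> 'a \<Rightarrow> 'a" where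
  "conj_action G = (\<lambda>g. \<lambda>h\<in>carrier G. g \<otimes>\<^bsub>G\<^esub> h \<otimes>\<^bsub>G\<^esub> inv\<^bsub>G\<^esub> g)"

definition conj_class :: "('a, 'b) monoid_scheme \<Rightarrow> 'a \<Rightarrow> 'a set" where
  "conj_class G x = orbit G (conj_action G) x"

definition num_conj_classes :: "('a, 'b) monoid_scheme \<Rightarrow> nat" where
  "num_conj_classes G = card (orbits G (carrier G) (conj_action G))"

definition commuting_matrix :: "('a, 'b) monoid_scheme \<Rightarrow> 'a \<Rightarrow> 'a \<Rightarrow> real" where
  "commuting_matrix G x y =
     (if x \<otimes>\<^bsub>G\<^esub> y = y \<otimes>\<^bsub>G\<^esub> x then 1 / real (card (centralizer G x)) else 0)"

definition commuting_stationary :: "('a, 'b) monoid_scheme \<Rightarrow> 'a \<Rightarrow> real" where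
  "commuting_stationary G x = 1 / (real (num_conj_classes G) * real (card (conj_class G x)))"

definition commuting_mixing_time :: "('a, 'b) monoid_scheme \<Rightarrow> real \<Rightarrow> enat" where
  "commuting_mixing_time G =
     mixing_time (carrier G) (commuting_matrix G) (commuting_stationary G)"

definition max_noncentral_centralizer :: "('a, 'b) monoid_scheme \<Rightarrow> nat" where
  "max_noncentral_centralizer G = (MAX x\<in>carrier G - center G. card (centralizer G x))"

end

theory Submission
  imports Defs
begin

text \<open>
  The two-step chain satisfies a Doeblin minorization: \<open>P\<^sup>2(x,y) \<ge> \<delta> / |G|\<close> with
  \<open>\<delta> = z / c\<^sub>\<star>\<close>. A noncentral \<open>x\<close> moves into the center with probability at least \<open>\<delta>\<close>, and from there
  the next step is uniform. A central \<open>x\<close> first makes a uniform step, and every \<open>y\<close> commutes with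
  a whole coset \<open>uZ\<close> of noncentral elements, each of which jumps to \<open>y\<close> with probability
  at least \<open>1 / c\<^sub>\<star>\<close>. Hence the oscillation of \<open>x \<mapsto> P\<^sup>t(x,A)\<close> contracts by the factor \<open>1 - \<delta>\<close>
  every two steps, which bounds the distance to the stationary distribution by
  \<open>(1 - \<delta>)\<^sup>m \<le> exp (- \<delta> m)\<close> for \<open>m = \<lfloor>t / 2\<rfloor>\<close>.
\<close>

section \<open>Doeblin minorization\<close>

text \<open>The weights may have any total mass: this serves both for a probability vector and for a
  kernel of mass \<open>1 - \<delta>\<close>.\<close>

lemma convex_sum_bounds:
  fixes w f :: "'a \<Rightarrow> real"
  assumes "\<And>x. x \<in> S \<Longrightarrow> 0 \<le> w x" and "\<And>x. x \<in> S \<Longrightarrow> a \<le> f x \<and> f x \<le> b"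
  shows "sum w S * a \<le> (\<Sum>x\<in>S. w x * f x)" and "(\<Sum>x\<in>S. w x * f x) \<le> sum w S * b"
  unfolding sum_distrib_right using assms by (auto intro!: sum_mono mult_left_mono)

lemma mat_pow_add:
  assumes "finite S" and "x \<in> S"
  shows "mat_pow S P (s + t) x y = (\<Sum>w\<in>S. mat_pow S P s x w * mat_pow S P t w y)"
  using assms(2)
proof (induction s arbitrary: x)
  case 0
  have "(\<Sum>w\<in>S. mat_pow S P 0 x w * mat_pow S P t w y)
      = (\<Sum>w\<in>S. if w = x then mat_pow S P t w y else 0)"
    by (intro sum.cong) auto
  then show ?case
    using 0 assms(1) by simp
next
  case (Suc s)
  have "mat_pow S P (Suc s + t) x y
      = (\<Sum>v\<in>S. \<Sum>w\<in>S. P x v * mat_pow S P s v w * mat_pow S P t w y)"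
    by (simp add: Suc.IH sum_distrib_left mult.assoc)
  also have "\<dots> = (\<Sum>w\<in>S. mat_pow S P (Suc s) x w * mat_pow S P t w y)"
    by (subst sum.swap) (simp add: sum_distrib_right)
  finally show ?case .
qed

lemma tv_dist_le:
  assumes "\<And>A. A \<subseteq> S \<Longrightarrow> \<bar>sum \<mu> A - sum \<nu> A\<bar> \<le> r"
  shows "tv_dist S \<mu> \<nu> \<le> r"
  unfolding tv_dist_def using assms by (intro cSUP_least) auto

section \<open>Contraction of a finite chain under a minorization\<close>

locale stochastic_matrix =
  fixes S :: "'a set" and P :: "'a \<Rightarrow> 'a \<Rightarrow> real"
  assumes finite_states: "finite S"
    and nonneg: "\<And>x y. x \<in> S \<Longrightarrow> y \<in> S \<Longrightarrow> 0 \<le> P x y"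
    and row_sum: "\<And>x. x \<in> S \<Longrightarrow> (\<Sum>y\<in>S. P x y) = 1"
begin

lemma mat_pow_nonneg: "x \<in> S \<Longrightarrow> y \<in> S \<Longrightarrow> 0 \<le> mat_pow S P t x y"
  by (induction t arbitrary: x) (auto intro!: sum_nonneg mult_nonneg_nonneg nonneg)

lemma mat_pow_row_sum: "x \<in> S \<Longrightarrow> (\<Sum>y\<in>S. mat_pow S P t x y) = 1"
proof (induction t arbitrary: x)
  case 0
  then show ?case using finite_states by simp
next
  case (Suc t)
  have "(\<Sum>y\<in>S. mat_pow S P (Suc t) x y) = (\<Sum>w\<in>S. P x w * (\<Sum>y\<in>S. mat_pow S P t w y))"
    by (simp add: sum_distrib_left) (rule sum.swap)
  then show ?case using Suc by (simp add: row_sum)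
qed

lemma stationary_mat_pow:
  assumes "\<And>y. y \<in> S \<Longrightarrow> (\<Sum>x\<in>S. \<pi> x * P x y) = \<pi> y" and "y \<in> S"
  shows "(\<Sum>x\<in>S. \<pi> x * mat_pow S P t x y) = \<pi> y"
proof (induction t)
  case 0
  have "(\<Sum>x\<in>S. \<pi> x * mat_pow S P 0 x y) = (\<Sum>x\<in>S. if x = y then \<pi> x else 0)"
    by (intro sum.cong) auto
  then show ?case using assms(2) finite_states by simp
next
  case (Suc t)
  have "(\<Sum>x\<in>S. \<pi> x * mat_pow S P (Suc t) x y)
      = (\<Sum>x\<in>S. \<Sum>w\<in>S. \<pi> x * P x w * mat_pow S P t w y)"
    by (simp add: sum_distrib_left mult.assoc)
  also have "\<dots> = (\<Sum>w\<in>S. (\<Sum>x\<in>S. \<pi> x * P x w) * mat_pow S P t w y)"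
    by (subst sum.swap) (simp add: sum_distrib_right)
  also have "\<dots> = \<pi> y"
    using Suc by (simp add: assms(1))
  finally show ?case .
qed

text \<open>Summing the minorization over \<open>y\<close> compares \<open>\<delta>\<close> with a
  row sum. This keeps the base \<open>1 - \<delta>\<close> nonnegative when powers are
  compared.\<close>

lemma minorization_constant_le_1:
  assumes "S \<noteq> {}" and "sum u S = 1"
    and "\<And>x y. x \<in> S \<Longrightarrow> y \<in> S \<Longrightarrow> \<delta> * u y \<le> mat_pow S P k x y"
  shows "\<delta> \<le> 1"
proof -
  obtain x where x: "x \<in> S" using assms(1) by blast
  have "\<delta> = (\<Sum>y\<in>S. \<delta> * u y)"
    using assms(2) by (simp flip: sum_distrib_left)
  also have "\<dots> \<le> (\<Sum>y\<in>S. mat_pow S P k x y)"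
    using assms(3) x by (intro sum_mono) auto
  finally show ?thesis by (simp add: mat_pow_row_sum x)
qed

text \<open>An enclosing interval of prescribed length replaces the exact maximum and minimum over
  \<open>x\<close>, so each round of \<open>k\<close> steps only has to shift and rescale
  it.\<close>

lemma oscillation_contracts:
  assumes k: "0 < k" and u: "sum u S = 1"
    and minor: "\<And>x y. x \<in> S \<Longrightarrow> y \<in> S \<Longrightarrow> \<delta> * u y \<le> mat_pow S P k x y"
    and A: "A \<subseteq> S"
  shows "\<exists>a b. (\<forall>x\<in>S. a \<le> sum (mat_pow S P t x) A \<and> sum (mat_pow S P t x) A \<le> b) \<and>
           b - a = (1 - \<delta>) ^ (t div k)"
proof (induction t rule: less_induct)
  case (less t)
  show ?case
  proof (cases "t < k")
    case True
    \<comment> \<open>Here \<open>t div k = 0\<close>, so the trivial interval from 0 to 1 has the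
      required length.\<close>
    have "0 \<le> sum (mat_pow S P t x) A \<and> sum (mat_pow S P t x) A \<le> 1" if "x \<in> S" for x
    proof
      show "0 \<le> sum (mat_pow S P t x) A"
        using A that by (intro sum_nonneg mat_pow_nonneg) auto
      show "sum (mat_pow S P t x) A \<le> 1"
        using sum_mono2[OF finite_states A, of "mat_pow S P t x"] that
        by (simp add: mat_pow_row_sum mat_pow_nonneg)
    qed
    then show ?thesis
      using True by (intro exI[of _ 0] exI[of _ 1]) auto
  next
    case False
    define s where "s = t - k"
    have t: "t = k + s" and "s < t"
      using False k by (auto simp: s_def)
    define h where "h = (\<lambda>w. sum (mat_pow S P s w) A)"
    obtain a b where h: "\<And>x. x \<in> S \<Longrightarrow> a \<le> h x \<and> h x \<le> b"
      and ab: "b - a = (1 - \<delta>) ^ (s div k)"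
      using less.IH[OF \<open>s < t\<close>] unfolding h_def by blast
    \<comment> \<open>Split the first \<open>k\<close> steps as \<open>\<delta> * u\<close> plus a
      residual kernel \<open>R\<close>. The first part contributes the constant \<open>c\<close>,
      the same for every \<open>x\<close>; only \<open>R\<close>, nonnegative of row mass
      \<open>1 - \<delta>\<close>, can separate starting points.\<close>
    define R where "R = (\<lambda>x y. mat_pow S P k x y - \<delta> * u y)"
    define c where "c = \<delta> * (\<Sum>y\<in>S. u y * h y)"
    have bounds: "c + (1 - \<delta>) * a \<le> sum (mat_pow S P t x) A \<and>
        sum (mat_pow S P t x) A \<le> c + (1 - \<delta>) * b" if x: "x \<in> S" for x
    proof -
      have "sum (mat_pow S P t x) A = (\<Sum>y\<in>A. \<Sum>w\<in>S. mat_pow S P k x w * mat_pow S P s w y)"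
        unfolding t by (simp add: mat_pow_add[OF finite_states x])
      also have "\<dots> = (\<Sum>w\<in>S. mat_pow S P k x w * h w)"
        by (subst sum.swap) (simp add: h_def sum_distrib_left)
      also have "\<dots> = (\<Sum>w\<in>S. \<delta> * (u w * h w) + R x w * h w)"
        by (simp add: R_def algebra_simps)
      also have "\<dots> = c + (\<Sum>w\<in>S. R x w * h w)"
        by (simp add: sum.distrib c_def sum_distrib_left)
      finally have eq: "sum (mat_pow S P t x) A = c + (\<Sum>w\<in>S. R x w * h w)" .
      have "sum (R x) S = (\<Sum>y\<in>S. mat_pow S P k x y) - \<delta> * sum u S"
        by (simp add: R_def sum_subtractf sum_distrib_left)
      then have R_sum: "sum (R x) S = 1 - \<delta>"
        by (simp add: mat_pow_row_sum x u)
      have R_nonneg: "0 \<le> R x y" if "y \<in> S" for y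
        using minor[OF x that] by (simp add: R_def)
      show ?thesis
        unfolding eq using convex_sum_bounds[of S "R x" a h b] R_nonneg h R_sum by auto
    qed
    have "c + (1 - \<delta>) * b - (c + (1 - \<delta>) * a) = (1 - \<delta>) * (b - a)"
      by (simp add: algebra_simps)
    also have "\<dots> = (1 - \<delta>) ^ (t div k)"
      using k by (simp add: ab t)
    finally show ?thesis using bounds by blast
  qed
qed

text \<open>By stationarity, the mass of \<open>A\<close> under \<open>\<pi>\<close> is a
  \<open>\<pi>\<close>-average of the \<open>t\<close>-step probabilities of \<open>A\<close>. Both
  therefore lie in the same interval, whose length bounds their difference.\<close>

theorem worst_dist_le_minorization:
  assumes nonempty: "S \<noteq> {}"
    and \<pi>_nonneg: "\<And>x. x \<in> S \<Longrightarrow> 0 \<le> \<pi> x" and \<pi>_sum: "sum \<pi> S = 1"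
    and stationary: "\<And>y. y \<in> S \<Longrightarrow> (\<Sum>x\<in>S. \<pi> x * P x y) = \<pi> y"
    and "0 < k" and "sum u S = 1"
    and "\<And>x y. x \<in> S \<Longrightarrow> y \<in> S \<Longrightarrow> \<delta> * u y \<le> mat_pow S P k x y"
  shows "worst_dist S P \<pi> t \<le> (1 - \<delta>) ^ (t div k)"
proof -
  have "\<bar>sum (mat_pow S P t x) A - sum \<pi> A\<bar> \<le> (1 - \<delta>) ^ (t div k)"
    if x: "x \<in> S" and A: "A \<subseteq> S" for x A
  proof -
    obtain a b where ab: "\<And>x. x \<in> S \<Longrightarrow> a \<le> sum (mat_pow S P t x) A \<and> sum (mat_pow S P t x) A \<le> b"
      and diff: "b - a = (1 - \<delta>) ^ (t div k)"
      using oscillation_contracts[OF assms(5-7) A, of t] by blast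
    have "sum \<pi> A = (\<Sum>y\<in>A. \<Sum>x\<in>S. \<pi> x * mat_pow S P t x y)"
      using A by (intro sum.cong) (auto simp: stationary_mat_pow[OF stationary])
    also have "\<dots> = (\<Sum>x\<in>S. \<pi> x * sum (mat_pow S P t x) A)"
      by (subst sum.swap) (simp add: sum_distrib_left)
    finally have "a \<le> sum \<pi> A" "sum \<pi> A \<le> b"
      using convex_sum_bounds[of S \<pi> a "\<lambda>x. sum (mat_pow S P t x) A" b] \<pi>_nonneg ab \<pi>_sum by auto
    with ab[OF x] diff show ?thesis by (simp add: abs_le_iff)
  qed
  then show ?thesis
    unfolding worst_dist_def using finite_states nonempty by (auto intro!: tv_dist_le)
qed

end

lemma mixing_time_le: "worst_dist S P \<pi> t \<le> \<epsilon> \<Longrightarrow> mixing_time S P \<pi> \<epsilon> \<le> enat t"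
  unfolding mixing_time_def by (intro Inf_lower) blast

section \<open>The commuting chain\<close>

lemma centralizer_subset: "centralizer G x \<subseteq> carrier G"
  by (auto simp: centralizer_def)

lemma centralizer_commute:
  "x \<in> carrier G \<Longrightarrow> y \<in> carrier G \<Longrightarrow> x \<in> centralizer G y \<longleftrightarrow> y \<in> centralizer G x"
  by (auto simp: centralizer_def)

lemma centralizer_of_central: "x \<in> center G \<Longrightarrow> centralizer G x = carrier G"
  by (auto simp: centralizer_def center_def)

lemma commuting_matrix_eq:
  "y \<in> carrier G \<Longrightarrow> commuting_matrix G x y =
    (if y \<in> centralizer G x then 1 / real (card (centralizer G x)) else 0)"
  by (auto simp: commuting_matrix_def centralizer_def)

section \<open>Centralizers and conjugacy classes\<close>

context group
begin

lemma one_in_center: "\<one> \<in> center G"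
  by (simp add: center_def)

lemma one_in_centralizer: "x \<in> carrier G \<Longrightarrow> \<one> \<in> centralizer G x"
  by (simp add: centralizer_def)

lemma self_in_centralizer: "x \<in> carrier G \<Longrightarrow> x \<in> centralizer G x"
  by (simp add: centralizer_def)

text \<open>Supplies a whole central coset of intermediate states once one such state
  \<open>u\<close> is known.\<close>

lemma mult_central_in_centralizer:
  assumes "x \<in> carrier G" "u \<in> centralizer G x" "c \<in> center G"
  shows "u \<otimes> c \<in> centralizer G x"
proof -
  have *: "u \<in> carrier G" "u \<otimes> x = x \<otimes> u" "c \<in> carrier G" "x \<otimes> c = c \<otimes> x"
    using assms by (auto simp: centralizer_def center_def)
  then have "u \<otimes> c \<otimes> x = x \<otimes> (u \<otimes> c)"
    by (metis assms(1) m_assoc)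
  then show ?thesis using * by (simp add: centralizer_def)
qed

text \<open>A central factor moves to the right end of both products and cancels. Hence all states
  of a central coset share one transition weight.\<close>

lemma centralizer_mult_central:
  assumes "u \<in> carrier G" "c \<in> center G"
  shows "centralizer G (u \<otimes> c) = centralizer G u"
proof -
  have c: "c \<in> carrier G" "\<And>h. h \<in> carrier G \<Longrightarrow> h \<otimes> c = c \<otimes> h"
    using assms by (auto simp: center_def)
  have "h \<otimes> (u \<otimes> c) = u \<otimes> c \<otimes> h \<longleftrightarrow> h \<otimes> u = u \<otimes> h" if h: "h \<in> carrier G" for h
  proof -
    have "h \<otimes> (u \<otimes> c) = h \<otimes> u \<otimes> c" "u \<otimes> c \<otimes> h = u \<otimes> h \<otimes> c"
      using assms(1) c(1) h by (simp_all add: m_assoc flip: c(2))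
    then show ?thesis using assms(1) c(1) h by simp
  qed
  then show ?thesis by (auto simp: centralizer_def)
qed

lemma conj_group_action: "group_action G (carrier G) (conj_action G)"
  unfolding conj_action_def by (rule action_by_conjugation)

lemma stabilizer_conj_action:
  assumes "x \<in> carrier G"
  shows "stabilizer G (conj_action G) x = centralizer G x"
proof -
  have "g \<otimes> x \<otimes> inv g = x \<longleftrightarrow> g \<otimes> x = x \<otimes> g" if "g \<in> carrier G" for g
    using assms that by (metis inv_closed inv_solve_right m_closed)
  then show ?thesis
    using assms by (auto simp: stabilizer_def centralizer_def conj_action_def)
qed

lemma card_conj_class_centralizer:
  "x \<in> carrier G \<Longrightarrow> card (conj_class G x) * card (centralizer G x) = order G"
  using group_action.orbit_stabilizer_theorem[OF conj_group_action]
  by (simp add: conj_class_def stabilizer_conj_action)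

text \<open>Distinct orbits are disjoint and \<open>x\<close> lies in its own. Thus the class size,
  and with it the stationary weight, is constant on each orbit.\<close>

lemma orbit_eq_conj_class:
  assumes "O' \<in> orbits G (carrier G) (conj_action G)" "x \<in> O'"
  shows "x \<in> carrier G" "O' = conj_class G x"
proof -
  interpret group_action G "carrier G" "conj_action G" by (rule conj_group_action)
  show x: "x \<in> carrier G" using assms orbits_coverture by blast
  then have "conj_class G x \<in> orbits G (carrier G) (conj_action G)" "x \<in> conj_class G x"
    using orbit_refl by (auto simp: conj_class_def orbits_def)
  then show "O' = conj_class G x" using assms disjoint_union by blast
qed

end

section \<open>The commuting chain of a finite non-abelian group\<close>

locale finite_nonabelian_group = group +
  assumes finite_carrier: "finite (carrier G)"
    and nonabelian: "\<not> comm_group G"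
begin

lemma finite_centralizer: "finite (centralizer G x)"
  by (rule finite_subset[OF centralizer_subset finite_carrier])

lemma card_centralizer_pos: "x \<in> carrier G \<Longrightarrow> 0 < card (centralizer G x)"
  using self_in_centralizer[of x] finite_centralizer[of x] by (auto simp: card_gt_0_iff)

lemma card_centralizer_le_order: "card (centralizer G x) \<le> order G"
  unfolding order_def by (intro card_mono finite_carrier centralizer_subset)

lemma order_pos: "0 < order G"
  using finite_carrier by (auto simp: order_def card_gt_0_iff)

lemma card_center_pos: "0 < card (center G)"
proof -
  have "finite (center G)"
    using finite_carrier by (simp add: center_def)
  then show ?thesis using one_in_center by (auto simp: card_gt_0_iff)
qed

lemma card_centralizer_le_max:
  assumes "x \<in> carrier G - center G"
  shows "card (centralizer G x) \<le> max_noncentral_centralizer G"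
  unfolding max_noncentral_centralizer_def using assms finite_carrier by (intro Max_ge) auto

text \<open>Makes the maximum defining \<open>max_noncentral_centralizer\<close> range over a
  nonempty set, and provides intermediate states between two central elements.\<close>

lemma noncentral_exists: "\<exists>x. x \<in> carrier G - center G"
proof (rule ccontr)
  assume "\<not> ?thesis"
  then have "comm_group G"
    by (intro group_comm_groupI) (auto simp: center_def)
  with nonabelian show False ..
qed

lemma max_noncentral_centralizer_pos: "0 < max_noncentral_centralizer G"
proof -
  obtain x where x: "x \<in> carrier G - center G" using noncentral_exists ..
  then have "0 < card (centralizer G x)" by (intro card_centralizer_pos) simp
  also have "\<dots> \<le> max_noncentral_centralizer G" using x by (rule card_centralizer_le_max)
  finally show ?thesis .
qed

sublocale stochastic_matrix "carrier G" "commuting_matrix G"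
proof
  show "finite (carrier G)" by (rule finite_carrier)
  show "0 \<le> commuting_matrix G x y" for x y
    by (simp add: commuting_matrix_def)
  fix x assume x: "x \<in> carrier G"
  have "(\<Sum>y\<in>carrier G. commuting_matrix G x y)
      = (\<Sum>y\<in>centralizer G x. 1 / real (card (centralizer G x)))"
    using centralizer_subset[of G x]
    by (intro sum.mono_neutral_cong_right) (auto simp: finite_carrier commuting_matrix_eq)
  then show "(\<Sum>y\<in>carrier G. commuting_matrix G x y) = 1"
    using card_centralizer_pos[OF x] by simp
qed

text \<open>Orbit-stabilizer turns the inverse class size into a centralizer size, which cancels
  against the row weight of \<open>commuting_matrix\<close>.\<close>

lemma commuting_stationary_eq:
  assumes "x \<in> carrier G"
  shows "commuting_stationary G x =
    real (card (centralizer G x)) / (real (num_conj_classes G) * real (order G))"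
proof -
  have "real (order G) = real (card (conj_class G x)) * real (card (centralizer G x))"
    using card_conj_class_centralizer[OF assms] by (simp flip: of_nat_mult)
  then show ?thesis
    using card_centralizer_pos[OF assms] by (simp add: commuting_stationary_def)
qed

text \<open>The flow from \<open>x\<close> to \<open>y\<close> is the same constant for every
  commuting pair, so only the number of elements commuting with \<open>y\<close> remains.\<close>

lemma commuting_stationary_stationary:
  assumes y: "y \<in> carrier G"
  shows "(\<Sum>x\<in>carrier G. commuting_stationary G x * commuting_matrix G x y)
    = commuting_stationary G y"
proof -
  have "(\<Sum>x\<in>carrier G. commuting_stationary G x * commuting_matrix G x y)
      = (\<Sum>x\<in>centralizer G y. 1 / (real (num_conj_classes G) * real (order G)))"
  proof (intro sum.mono_neutral_cong_right ballI finite_carrier centralizer_subset)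
    fix x assume "x \<in> carrier G - centralizer G y"
    then show "commuting_stationary G x * commuting_matrix G x y = 0"
      using y centralizer_commute[of x G y] by (simp add: commuting_matrix_eq)
  next
    fix x assume "x \<in> centralizer G y"
    then have "x \<in> carrier G" "y \<in> centralizer G x"
      using y centralizer_subset[of G y] centralizer_commute[of x G y] by auto
    then show "commuting_stationary G x * commuting_matrix G x y
        = 1 / (real (num_conj_classes G) * real (order G))"
      using y card_centralizer_pos[of x] by (simp add: commuting_matrix_eq commuting_stationary_eq)
  qed
  then show ?thesis using y by (simp add: commuting_stationary_eq)
qed

text \<open>Summed class by class, each conjugacy class carries the same mass, the inverse of the
  number of classes.\<close>

lemma commuting_stationary_sum: "sum (commuting_stationary G) (carrier G) = 1"
proof -
  interpret group_action G "carrier G" "conj_action G" by (rule conj_group_action)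
  let ?O = "orbits G (carrier G) (conj_action G)"
  have fin: "finite ?O"
    using finite_carrier by (simp add: orbits_def)
  have "?O \<noteq> {}" by (auto simp: orbits_def)
  then have pos: "0 < num_conj_classes G"
    using fin by (simp add: num_conj_classes_def card_gt_0_iff)
  have "sum (commuting_stationary G) (carrier G) = (\<Sum>C\<in>?O. sum (commuting_stationary G) C)"
    by (simp add: disjoint_sum finite_carrier)
  also have "\<dots> = (\<Sum>C\<in>?O. 1 / real (num_conj_classes G))"
  proof (intro sum.cong refl)
    fix C assume C: "C \<in> ?O"
    have "finite C" using C orbits_coverture finite_carrier by (blast intro: finite_subset)
    moreover have "C \<noteq> {}" using C orbit_refl by (auto simp: orbits_def)
    ultimately have "0 < card C" by (simp add: card_gt_0_iff)
    have "sum (commuting_stationary G) C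
        = (\<Sum>x\<in>C. 1 / (real (num_conj_classes G) * real (card C)))"
      using orbit_eq_conj_class(2)[OF C]
      by (intro sum.cong) (auto simp: commuting_stationary_def)
    then show "sum (commuting_stationary G) C = 1 / real (num_conj_classes G)"
      using \<open>0 < card C\<close> by simp
  qed
  also have "\<dots> = 1"
    using pos by (simp flip: num_conj_classes_def)
  finally show ?thesis .
qed

lemma two_step_minorization:
  assumes x: "x \<in> carrier G" and y: "y \<in> carrier G"
  defines "\<delta> \<equiv> real (card (center G)) / real (max_noncentral_centralizer G)"
  shows "\<delta> * (1 / real (order G)) \<le> mat_pow (carrier G) (commuting_matrix G) 2 x y"
proof -
  let ?C = "centralizer G" and ?P = "commuting_matrix G"
  \<comment> \<open>All paths from \<open>x\<close> to \<open>y\<close> through the central coset of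
    \<open>u\<close> have equal probability. The choice of \<open>u\<close> makes one of the two
    centralizers noncentral in type, bounded by the maximum, while the other is at most the whole
    group.\<close>
  obtain u where u: "u \<in> ?C x" "u \<in> ?C y"
    and card: "card (?C x) * card (?C u) \<le> max_noncentral_centralizer G * order G"
  proof (cases "x \<in> center G")
    case False
    have "card (?C x) * card (?C \<one>) \<le> max_noncentral_centralizer G * order G"
      using False x by (intro mult_le_mono card_centralizer_le_max card_centralizer_le_order) auto
    then show ?thesis
      using that[of \<one>] one_in_centralizer x y by simp
  next
    case True
    \<comment> \<open>For central \<open>x\<close> the bound must come from \<open>u\<close>, so
      \<open>u\<close> has to be noncentral: \<open>y\<close> itself if possible, otherwise any
      noncentral element, since a central \<open>y\<close> commutes with it.\<close>
    obtain u where u: "u \<in> carrier G - center G" "u \<in> ?C y"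
    proof (cases "y \<in> center G")
      case True
      obtain u where "u \<in> carrier G - center G" using noncentral_exists ..
      with True show ?thesis by (intro that) (auto simp: centralizer_of_central)
    next
      case False
      with y show ?thesis by (intro that) (auto simp: self_in_centralizer)
    qed
    have "card (?C u) * card (?C x) \<le> max_noncentral_centralizer G * order G"
      using u by (intro mult_le_mono card_centralizer_le_max card_centralizer_le_order) auto
    then show ?thesis
      using that[of u] u centralizer_of_central[OF True] by (simp add: mult.commute)
  qed
  have uG: "u \<in> carrier G" using u(1) by (simp add: centralizer_def)
  have inj: "inj_on (\<lambda>c. u \<otimes> c) (center G)"
    using uG by (auto simp: inj_on_def center_def)
  have sub: "(\<lambda>c. u \<otimes> c) ` center G \<subseteq> carrier G"
    using uG by (auto simp: center_def)
  have "\<delta> * (1 / real (order G))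
      = real (card (center G)) / real (max_noncentral_centralizer G * order G)"
    by (simp add: \<delta>_def)
  also have "\<dots> \<le> real (card (center G)) / real (card (?C x) * card (?C u))"
    using card card_centralizer_pos[OF x] card_centralizer_pos[OF uG]
    by (intro frac_le) (simp_all only: of_nat_le_iff of_nat_0_le_iff of_nat_0_less_iff
        nat_0_less_mult_iff order_refl simp_thms)
  also have "\<dots> = (\<Sum>c\<in>center G. 1 / real (card (?C x)) * (1 / real (card (?C u))))"
    by simp
  also have "\<dots> = (\<Sum>c\<in>center G. ?P x (u \<otimes> c) * ?P (u \<otimes> c) y)"
  proof (intro sum.cong refl)
    fix c assume c: "c \<in> center G"
    have "u \<otimes> c \<in> carrier G" using c uG by (simp add: center_def)
    moreover have "u \<otimes> c \<in> ?C x" "u \<otimes> c \<in> ?C y"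
      using x y u c by (simp_all add: mult_central_in_centralizer)
    ultimately show "1 / real (card (?C x)) * (1 / real (card (?C u)))
        = ?P x (u \<otimes> c) * ?P (u \<otimes> c) y"
      using y centralizer_commute[of "u \<otimes> c" G y]
      by (simp add: commuting_matrix_eq centralizer_mult_central[OF uG c])
  qed
  \<comment> \<open>Translation by \<open>u\<close> is injective, so the coset has as many elements
    as the center; the remaining intermediate states only add nonnegative terms.\<close>
  also have "\<dots> = (\<Sum>w\<in>(\<lambda>c. u \<otimes> c) ` center G. ?P x w * ?P w y)"
    by (simp add: sum.reindex[OF inj])
  also have "\<dots> \<le> (\<Sum>w\<in>carrier G. ?P x w * ?P w y)"
    using x y by (intro sum_mono2 finite_carrier sub mult_nonneg_nonneg nonneg) auto
  \<comment> \<open>Unfolding \<open>mat_pow\<close> leaves a trailing identity matrix, whose sum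
    collapses because \<open>y\<close> is a state.\<close>
  also have "\<dots> = mat_pow (carrier G) ?P 2 x y"
    using y by (simp add: numeral_2_eq_2 finite_carrier if_distrib cong: if_cong)
  finally show ?thesis .
qed

lemma commuting_worst_dist_le:
  "worst_dist (carrier G) (commuting_matrix G) (commuting_stationary G) t
    \<le> exp (- (real (card (center G)) / real (max_noncentral_centralizer G)) * real (t div 2))"
proof -
  define \<delta> where "\<delta> = real (card (center G)) / real (max_noncentral_centralizer G)"
  define u where "u = (\<lambda>y::'a. 1 / real (order G))"
  have nonempty: "carrier G \<noteq> {}" by blast
  have u: "sum u (carrier G) = 1"
    using order_pos by (simp add: u_def order_def)
  have minor: "\<delta> * u y \<le> mat_pow (carrier G) (commuting_matrix G) 2 x y"
    if "x \<in> carrier G" "y \<in> carrier G" for x y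
    unfolding \<delta>_def u_def using that by (rule two_step_minorization)
  have "worst_dist (carrier G) (commuting_matrix G) (commuting_stationary G) t
      \<le> (1 - \<delta>) ^ (t div 2)"
    by (rule worst_dist_le_minorization[OF nonempty _ commuting_stationary_sum
          commuting_stationary_stationary _ u minor])
      (auto simp: commuting_stationary_def)
  \<comment> \<open>Uses \<open>1 - \<delta> \<le> exp (- \<delta>)\<close>; raising it to a power
    needs the nonnegativity of \<open>1 - \<delta>\<close>.\<close>
  also have "\<dots> \<le> exp (- \<delta>) ^ (t div 2)"
    using minorization_constant_le_1[OF nonempty u minor] exp_ge_add_one_self[of "- \<delta>"]
    by (intro power_mono) auto
  also have "\<dots> = exp (- \<delta> * real (t div 2))"
    by (simp flip: exp_of_nat2_mult)
  finally show ?thesis by (simp add: \<delta>_def)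
qed

end

theorem theorem2p2:
  fixes G :: "('a, 'b) monoid_scheme" and \<epsilon> :: real
  assumes "group G"
    and "finite (carrier G)"
    and "\<not> comm_group G"
    and "0 < \<epsilon>" and "\<epsilon> < 1"
  shows "commuting_mixing_time G \<epsilon> \<le>
    enat (nat \<lceil>2 * real (max_noncentral_centralizer G) / real (card (center G)) * ln (1 / \<epsilon>) + 2\<rceil>)"
proof -
  interpret finite_nonabelian_group G
    using assms(1-3) by (intro finite_nonabelian_group.intro finite_nonabelian_group_axioms.intro)
  define \<delta> where "\<delta> = real (card (center G)) / real (max_noncentral_centralizer G)"
  define r where "r = 2 * real (max_noncentral_centralizer G) / real (card (center G)) * ln (1 / \<epsilon>) + 2"
  define t where "t = nat \<lceil>r\<rceil>"
  have \<delta>: "0 < \<delta>"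
    using card_center_pos max_noncentral_centralizer_pos by (simp add: \<delta>_def)
  have r: "r = 2 * (ln (1 / \<epsilon>) / \<delta>) + 2"
    by (simp add: r_def \<delta>_def)
  have "r \<le> real t"
    unfolding t_def by (rule real_nat_ceiling_ge)
  \<comment> \<open>Halving an odd \<open>t\<close> loses one step; the summand 2 in
    \<open>r\<close> absorbs this loss.\<close>
  moreover have "real t \<le> 2 * real (t div 2) + 1"
    by linarith
  ultimately have "ln (1 / \<epsilon>) / \<delta> \<le> real (t div 2)"
    unfolding r by linarith
  then have "ln (1 / \<epsilon>) \<le> \<delta> * real (t div 2)"
    using \<delta> by (simp add: field_simps)
  then have "- \<delta> * real (t div 2) \<le> ln \<epsilon>"
    using assms(4) by (simp add: ln_div)
  then have "exp (- \<delta> * real (t div 2)) \<le> \<epsilon>"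
    using assms(4) by (metis exp_le_cancel_iff exp_ln)
  then have "worst_dist (carrier G) (commuting_matrix G) (commuting_stationary G) t \<le> \<epsilon>"
    using commuting_worst_dist_le[of t] by (simp add: \<delta>_def)
  then show ?thesis
    unfolding commuting_mixing_time_def t_def r_def by (rule mixing_time_le)
qed

end
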